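(* Let $n\ge2$. A couple of rational functions $A,F$ is a good solution of $$A\circ z^n=z^n\circ F$$ if and only if $A=z^rR(z)^n$ and $F=z^rR(z^n)$, where $R\in\mathbb C(z)$ and $r$ is an integer with $\gcd(r,n)=1$. In particular, if $\mathcal O$ is the orbifold on $\mathbb{CP}^1$ defined by $\nu(0)=\nu(\infty)=n$ (and $\nu(z)=1$ at all other points), then any minimal holomorphic map $A:\mathcal O\to\mathcal O$ has the form $A=z^rR(z)^n$ for some $R\in\mathbb C(z)$ and some integer $r$ with $\gcd(r,n)=1$.
   Context: All rational functions considered as maps are nonconstant. Rational functions $f,p,g,q$ with $f\circ p=g\circ q$ form a good solution of this equation if the fiber product $\{(x,y)\in\mathbb{CP}^1\times\mathbb{CP}^1: f(x)=g(y)\}$ has a unique component (equivalently, the algebraic curve $f(x)-g(y)=0$ is irreducible) and $p,q$ have no non-trivial common compositional right factor, i.e. $p=\tilde p\circ w$, $q=\tilde q\circ w$ with rational $\tilde p,\tilde q,w$ implies $\deg w=1$. The couple $A,F$ is a good solution of $A\circ z^n=z^n\circ F$ if $f=A$, $p=z^n$, $g=z^n$, $q=F$ is a good solution in this sense. For an orbifold on $\mathbb{CP}^1$ with ramification function $\nu$ (a function $\mathbb{CP}^1\to\mathbb N$ equal to $1$ outside a finite set), a rational function $A$ is a minimal holomorphic map $A:\mathcal O\to\mathcal O$ if $\nu(A(z))=\nu(z)\gcd(\deg_zA,\nu(A(z)))$ for all $z\in\mathbb{CP}^1$, where $\deg_zA$ is the local degree. *)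

theory Defs
  imports
    "HOL-Computational_Algebra.Computational_Algebra"
    "HOL-Computational_Algebra.Field_as_Ring"
begin

type_synonym ratfun = "complex poly fract"

datatype sphere = Pt complex | Infty

definition rconst :: "complex \<Rightarrow> ratfun" where
  "rconst c = to_fract [:c:]"

definition zvar :: ratfun where
  "zvar = to_fract [:0, 1:]"

definition nonconstant :: "ratfun \<Rightarrow> bool" where
  "nonconstant f \<longleftrightarrow> f \<notin> range rconst"

(* quot_of_fract yields the representation in lowest terms with monic denominator. *)
definition numer :: "ratfun \<Rightarrow> complex poly" where
  "numer f = fst (quot_of_fract f)"

definition denom :: "ratfun \<Rightarrow> complex poly" where
  "denom f = snd (quot_of_fract f)"

definition rat_degree :: "ratfun \<Rightarrow> nat" where
  "rat_degree f = max (degree (numer f)) (degree (denom f))"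

(* Substitution f(g(z)) in the field C(z).  If g is a constant that is a pole of f,
   the division by zero returns 0; for nonconstant g the divisor is never zero. *)
definition rat_compose :: "ratfun \<Rightarrow> ratfun \<Rightarrow> ratfun" (infixl "\<circ>\<^sub>r" 75) where
  "f \<circ>\<^sub>r g = poly (map_poly rconst (numer f)) g / poly (map_poly rconst (denom f)) g"

definition value_at :: "ratfun \<Rightarrow> complex \<Rightarrow> sphere" where
  "value_at f a =
     (if poly (denom f) a = 0 then Infty else Pt (poly (numer f) a / poly (denom f) a))"

(* The coordinate at infinity is 1/z. *)
primrec rat_map :: "ratfun \<Rightarrow> sphere \<Rightarrow> sphere" where
  "rat_map f (Pt a) = value_at f a"
| "rat_map f Infty = value_at (f \<circ>\<^sub>r inverse zvar) 0"

definition order_at :: "complex \<Rightarrow> ratfun \<Rightarrow> int" where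
  "order_at a f = int (order a (numer f)) - int (order a (denom f))"

definition local_degree_at :: "ratfun \<Rightarrow> complex \<Rightarrow> nat" where
  "local_degree_at f a =
     (case value_at f a of
        Pt b \<Rightarrow> nat (order_at a (f - rconst b))
      | Infty \<Rightarrow> nat (- order_at a f))"

primrec local_degree :: "ratfun \<Rightarrow> sphere \<Rightarrow> nat" where
  "local_degree f (Pt a) = local_degree_at f a"
| "local_degree f Infty = local_degree_at (f \<circ>\<^sub>r inverse zvar) 0"

primrec hom_coords :: "sphere \<Rightarrow> complex \<times> complex" where
  "hom_coords (Pt x) = (x, 1)"
| "hom_coords Infty = (1, 0)"

(* The bihomogeneous polynomial of bidegree (d, e) with coefficients c. Whether it
   vanishes does not depend on the chosen homogeneous coordinates. *)
definition bihom_eval ::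
  "nat \<Rightarrow> nat \<Rightarrow> (nat \<Rightarrow> nat \<Rightarrow> complex) \<Rightarrow> sphere \<times> sphere \<Rightarrow> complex" where
  "bihom_eval d e c P =
     (let (x0, x1) = hom_coords (fst P); (y0, y1) = hom_coords (snd P)
      in \<Sum>i\<le>d. \<Sum>j\<le>e. c i j * x0 ^ i * x1 ^ (d - i) * y0 ^ j * y1 ^ (e - j))"

definition zariski_closed :: "(sphere \<times> sphere) set \<Rightarrow> bool" where
  "zariski_closed S \<longleftrightarrow>
     (\<exists>H. S = {P. \<forall>(d, e, c) \<in> H. bihom_eval d e c P = 0})"

definition zariski_irreducible :: "(sphere \<times> sphere) set \<Rightarrow> bool" where
  "zariski_irreducible S \<longleftrightarrow> S \<noteq> {} \<and>
     (\<forall>C D. zariski_closed C \<and> zariski_closed D \<and> S \<subseteq> C \<union> D \<longrightarrow> S \<subseteq> C \<or> S \<subseteq> D)"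

definition is_component :: "(sphere \<times> sphere) set \<Rightarrow> (sphere \<times> sphere) set \<Rightarrow> bool" where
  "is_component C S \<longleftrightarrow> C \<subseteq> S \<and> zariski_irreducible C \<and>
     (\<forall>D. C \<subseteq> D \<and> D \<subseteq> S \<and> zariski_irreducible D \<longrightarrow> D = C)"

definition fiber_product :: "ratfun \<Rightarrow> ratfun \<Rightarrow> (sphere \<times> sphere) set" where
  "fiber_product f g = {(x, y). rat_map f x = rat_map g y}"

definition no_common_right_factor :: "ratfun \<Rightarrow> ratfun \<Rightarrow> bool" where
  "no_common_right_factor p q \<longleftrightarrow>
     (\<forall>p' q' w. nonconstant p' \<and> nonconstant q' \<and> nonconstant w \<and>
        p = p' \<circ>\<^sub>r w \<and> q = q' \<circ>\<^sub>r w \<longrightarrow> rat_degree w = 1)"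

definition good_solution :: "ratfun \<Rightarrow> ratfun \<Rightarrow> ratfun \<Rightarrow> ratfun \<Rightarrow> bool" where
  "good_solution f p g q \<longleftrightarrow>
     nonconstant f \<and> nonconstant p \<and> nonconstant g \<and> nonconstant q \<and>
     f \<circ>\<^sub>r p = g \<circ>\<^sub>r q \<and>
     (\<exists>!C. is_component C (fiber_product f g)) \<and>
     no_common_right_factor p q"

definition orbifold :: "(sphere \<Rightarrow> nat) \<Rightarrow> bool" where
  "orbifold \<nu> \<longleftrightarrow> (\<forall>z. \<nu> z \<ge> 1) \<and> finite {z. \<nu> z \<noteq> 1}"

definition minimal_holomorphic_map :: "(sphere \<Rightarrow> nat) \<Rightarrow> ratfun \<Rightarrow> bool" where
  "minimal_holomorphic_map \<nu> A \<longleftrightarrow> orbifold \<nu> \<and> nonconstant A \<and>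
     (\<forall>z. \<nu> (rat_map A z) = \<nu> z * gcd (local_degree A z) (\<nu> (rat_map A z)))"

definition orbifold_0_infty :: "nat \<Rightarrow> sphere \<Rightarrow> nat" where
  "orbifold_0_infty n z = (if z = Pt 0 \<or> z = Infty then n else 1)"

lemma orbifold_orbifold_0_infty: "n \<ge> 1 \<Longrightarrow> orbifold (orbifold_0_infty n)"
  by (auto simp: orbifold_def orbifold_0_infty_def
      intro: finite_subset[where B = "{Pt 0, Infty}"])

end

theory Submission
  imports Defs
begin

text \<open>
  If $A(z^n) = F(z)^n$, then $F^n$ is unchanged when $z$ is replaced by $\zeta z$ for a primitive
  $n$-th root of unity $\zeta$. So the rotation multiplies $F$, and in fact its numerator and its
  denominator separately, by constants. A polynomial that is an eigenvector of the rotation has all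
  its exponents in one residue class modulo $n$, which gives $F = z^r R(z^n)$. Since composition
  with $z^n$ is injective, $A = z^r R^n$ follows. If $d = \gcd(r,n)$, then $z^d$ is a common right
  factor of $z^n$ and $F$, so $d = 1$
  (\<open>nth_power_in_zvar_power_imp_form\<close>, \<open>good_solution_normal_form\<close>).

  Conversely, let $A = z^r R^n$ and $F = z^r R(z^n)$ with $\gcd(r,n) = 1$. If $z^n$ and $F$ are
  rational functions of $w$, then so is $z^r = F / R(z^n)$, and by Bezout so is $z$ itself. This
  makes $w$ injective, and an injective rational function has degree at most one
  (\<open>no_common_right_factor_normal_form\<close>). The curve $A(x) = y^n$ is irreducible because it is the
  image of the projective line under $t \mapsto (t^n, F(t))$. Every point is reached: once
  $t^n = x$ is solved, $F(t)$ and $y$ differ by an $n$-th root of unity, which is removed by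
  rotating $t$, because the rotations act on $F$ through all $n$-th roots of unity when
  $\gcd(r,n) = 1$ (\<open>fiber_product_parametrized\<close>). The image of the line is Zariski irreducible
  because a bihomogeneous form pulls back to a polynomial, which vanishes identically or has
  finitely many zeros (\<open>zariski_irreducible_range\<close>).

  For the orbifold, minimality at a point $z \neq 0, \infty$ with value $0$ or $\infty$ forces $n$
  to divide the multiplicity, and minimality at $0$ forces $A(0) \in \{0, \infty\}$ with
  multiplicity prime to $n$. Factoring numerator and denominator over the complex numbers then
  exhibits $A$ as a power of $z$ times an $n$-th power
  (\<open>minimal_map_zvar_times_nth_power\<close>).
\<close>

section \<open>Composition of rational functions\<close>

lemma rconst_simps [simp]:
  "rconst 0 = 0" "rconst 1 = 1"
  "rconst (a + b) = rconst a + rconst b"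
  "rconst (a - b) = rconst a - rconst b"
  "rconst (a * b) = rconst a * rconst b"
  "rconst a = rconst b \<longleftrightarrow> a = b"
  "rconst a = 0 \<longleftrightarrow> a = 0"
proof -
  have add: "[:a + b:] = [:a:] + [:b:]" and diff: "[:a - b:] = [:a:] - [:b:]"
    and mult: "[:a * b:] = [:a:] * [:b:]"
    by simp_all
  show "rconst 0 = 0" "rconst 1 = 1" "rconst a = rconst b \<longleftrightarrow> a = b" "rconst a = 0 \<longleftrightarrow> a = 0"
    by (auto simp: rconst_def simp flip: one_pCons)
  show "rconst (a + b) = rconst a + rconst b" unfolding rconst_def add by (rule to_fract_add)
  show "rconst (a - b) = rconst a - rconst b" unfolding rconst_def diff by (rule to_fract_diff)
  show "rconst (a * b) = rconst a * rconst b" unfolding rconst_def mult by (rule to_fract_mult)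
qed

lemma rconst_power: "rconst (a ^ k) = rconst a ^ k"
  by (induction k) simp_all

lemma rconst_inverse: "rconst (inverse a) = inverse (rconst a)"
proof (cases "a = 0")
  case False
  have "rconst a * rconst (inverse a) = 1"
    using False by (simp flip: rconst_simps(5))
  then show ?thesis by (metis inverse_unique)
qed simp

lemma rconst_power_int: "rconst (a powi k) = rconst a powi k"
  by (simp add: power_int_def rconst_power rconst_inverse)

lemma to_fract_power: "to_fract (p ^ k) = to_fract p ^ k"
  by (induction k) simp_all

lemma zvar_nonzero [simp]: "zvar \<noteq> 0"
  by (simp add: zvar_def)

lemma zvar_power: "zvar ^ k = to_fract (monom 1 k)"
  by (simp add: zvar_def monom_altdef to_fract_power)

lemma ratfun_quot: "f = to_fract (numer f) / to_fract (denom f)"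
  using Fract_quot_of_fract[of f] by (simp add: numer_def denom_def Fract_conv_to_fract)

lemma denom_nonzero [simp]: "denom f \<noteq> 0"
  by (simp add: denom_def)

lemma coprime_numer_denom: "coprime (numer f) (denom f)"
  by (simp add: numer_def denom_def coprime_quot_of_fract)

lemma numer_to_fract [simp]: "numer (to_fract p) = p" 
  and denom_to_fract [simp]: "denom (to_fract p) = 1"
  by (simp_all add: numer_def denom_def)

lemma numer_eq_0_iff [simp]: "numer f = 0 \<longleftrightarrow> f = 0"
  by (simp add: numer_def)

lemma numer_0 [simp]: "numer 0 = 0"
  by simp

text \<open>
  The numerator and denominator are those of the reduced fraction. Every comparison with an
  arbitrary fraction representing the same function goes through this equation.
\<close>

lemma quot_cross_multiply:
  assumes "f = to_fract p / to_fract q" "q \<noteq> 0"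
  shows "p * denom f = numer f * q"
proof -
  have "to_fract p / to_fract q = to_fract (numer f) / to_fract (denom f)"
    using ratfun_quot[of f] unfolding assms(1) .
  then have "to_fract p * to_fract (denom f) = to_fract (numer f) * to_fract q"
    using assms(2) by (subst (asm) frac_eq_eq) simp_all
  then have "to_fract (p * denom f) = to_fract (numer f * q)" by simp
  then show ?thesis by (simp only: to_fract_eq_iff)
qed

lemma nonconstant_to_fract_iff: "nonconstant (to_fract p) \<longleftrightarrow> degree p > 0"
proof -
  have "to_fract p \<in> range rconst \<longleftrightarrow> degree p = 0"
    by (auto simp: rconst_def degree_eq_zeroE)
       (metis degree_eq_zeroE rangeI)
  then show ?thesis by (auto simp: nonconstant_def)
qed

lemma nonconstant_zvar_power: "k > 0 \<Longrightarrow> nonconstant (zvar ^ k)"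
  by (simp add: zvar_power nonconstant_to_fract_iff degree_monom_eq)

lemma nonconstant_inverse: "nonconstant f \<Longrightarrow> nonconstant (inverse f)"
  by (auto simp: nonconstant_def image_def) (metis inverse_inverse_eq rconst_inverse)

lemma nonconstant_nonzero: "nonconstant f \<Longrightarrow> f \<noteq> 0"
  by (metis nonconstant_def rangeI rconst_simps(1))

text \<open>
  Substitution of $g$ into a polynomial is a ring homomorphism for every $g$. Rational
  functions need a nonconstant $g$, so the polynomial case is isolated.
\<close>

definition subst_poly :: "complex poly \<Rightarrow> ratfun \<Rightarrow> ratfun" where
  "subst_poly p g = poly (map_poly rconst p) g"

lemma subst_poly_0 [simp]: "subst_poly 0 g = 0"
  by (simp add: subst_poly_def)

lemma subst_poly_pCons [simp]: "subst_poly (pCons a p) g = rconst a + g * subst_poly p g"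
  by (simp add: subst_poly_def map_poly_pCons)

lemma subst_poly_1 [simp]: "subst_poly 1 g = 1"
  by (simp add: one_pCons)

lemma subst_poly_add: "subst_poly (p + q) g = subst_poly p g + subst_poly q g"
  by (induction p q rule: poly_induct2) (simp_all add: algebra_simps)

lemma subst_poly_smult: "subst_poly (smult c p) g = rconst c * subst_poly p g"
  by (induction p) (simp_all add: algebra_simps)

lemma subst_poly_mult: "subst_poly (p * q) g = subst_poly p g * subst_poly q g"
  by (induction p) (simp_all add: subst_poly_add subst_poly_smult algebra_simps)

lemma subst_poly_to_fract: "subst_poly p (to_fract q) = to_fract (pcompose p q)"
  by (induction p) (simp_all add: pcompose_pCons rconst_def)

text \<open>
  A nonconstant rational function is transcendental over the complex numbers: a polynomial
  splits into linear factors, and none of the factors $g - a$ vanishes.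
\<close>

lemma subst_poly_nonzero:
  assumes "nonconstant g" "p \<noteq> 0"
  shows "subst_poly p g \<noteq> 0"
  using assms(2)
proof (induction "degree p" arbitrary: p)
  case 0
  then obtain c where "p = [:c:]" by (metis degree_eq_zeroE)
  with 0 show ?case by simp
next
  case (Suc d)
  then obtain a where "poly p a = 0"
    using fundamental_theorem_of_algebra_alt[of p] by force
  then obtain q where q: "p = [:- a, 1:] * q" by (metis dvdE poly_eq_0_iff_dvd)
  have "q \<noteq> 0" using q Suc.prems by auto
  moreover have "degree q = d"
    using q \<open>q \<noteq> 0\<close> Suc.hyps(2) by (simp add: degree_mult_eq del: mult_pCons_left)
  ultimately have "subst_poly q g \<noteq> 0" using Suc.hyps(1) by blast
  moreover have "rconst (- a) + g \<noteq> 0"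
  proof
    assume "rconst (- a) + g = 0"
    moreover have "rconst (- a) = - rconst a"
      using rconst_simps(4)[of 0 a] by simp
    ultimately have "g = rconst a" by simp
    then show False using assms(1) by (simp add: nonconstant_def)
  qed
  ultimately show ?case
    by (simp only: q subst_poly_mult) simp
qed

lemma rat_compose_subst: "f \<circ>\<^sub>r g = subst_poly (numer f) g / subst_poly (denom f) g"
  by (simp add: rat_compose_def subst_poly_def)

text \<open>
  Composition may be computed from any representing fraction. This is what turns
  substitution into a homomorphism of fields.
\<close>

lemma rat_compose_quot:
  assumes "nonconstant g" "q \<noteq> 0"
  shows "(to_fract p / to_fract q) \<circ>\<^sub>r g = subst_poly p g / subst_poly q g"
proof -
  define f where "f = to_fract p / to_fract q"
  have "p * denom f = numer f * q"
    using f_def assms(2) by (rule quot_cross_multiply)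
  then have "subst_poly p g * subst_poly (denom f) g = subst_poly (numer f) g * subst_poly q g"
    by (simp flip: subst_poly_mult)
  moreover have "subst_poly q g \<noteq> 0" "subst_poly (denom f) g \<noteq> 0"
    using subst_poly_nonzero assms by simp_all
  ultimately show ?thesis
    by (simp add: rat_compose_subst flip: f_def) (simp add: field_simps)
qed

lemma rat_compose_to_fract: "to_fract p \<circ>\<^sub>r g = subst_poly p g"
  by (simp add: rat_compose_subst)

lemma rat_compose_rconst [simp]: "rconst c \<circ>\<^sub>r g = rconst c"
  by (simp add: rconst_def rat_compose_to_fract)

lemma rat_compose_0 [simp]: "0 \<circ>\<^sub>r g = 0" and rat_compose_1 [simp]: "1 \<circ>\<^sub>r g = 1"
  using rat_compose_rconst[of 0 g] rat_compose_rconst[of 1 g] by simp_all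

lemma rat_compose_zvar [simp]: "zvar \<circ>\<^sub>r g = g"
  by (simp add: zvar_def rat_compose_to_fract)

lemma rat_compose_add:
  assumes "nonconstant g"
  shows "(f + h) \<circ>\<^sub>r g = (f \<circ>\<^sub>r g) + (h \<circ>\<^sub>r g)"
proof -
  have eq: "f + h = to_fract (numer f * denom h + numer h * denom f) / to_fract (denom f * denom h)"
    by (subst (1) ratfun_quot[of f], subst (1) ratfun_quot[of h]) (simp add: field_simps)
  have "subst_poly (denom f) g \<noteq> 0" "subst_poly (denom h) g \<noteq> 0"
    using subst_poly_nonzero assms by simp_all
  then show ?thesis
    unfolding eq using assms
    by (subst rat_compose_quot)
       (simp_all add: rat_compose_subst subst_poly_add subst_poly_mult field_simps)
qed

lemma rat_compose_mult:
  assumes "nonconstant g"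
  shows "(f * h) \<circ>\<^sub>r g = (f \<circ>\<^sub>r g) * (h \<circ>\<^sub>r g)"
proof -
  have eq: "f * h = to_fract (numer f * numer h) / to_fract (denom f * denom h)"
    by (subst (1) ratfun_quot[of f], subst (1) ratfun_quot[of h]) simp
  show ?thesis
    unfolding eq using assms
    by (subst rat_compose_quot) (simp_all add: rat_compose_subst subst_poly_mult)
qed

lemma rat_compose_diff:
  assumes "nonconstant g"
  shows "(f - h) \<circ>\<^sub>r g = (f \<circ>\<^sub>r g) - (h \<circ>\<^sub>r g)"
  using rat_compose_add[OF assms, of "f - h" h] by simp

lemma rat_compose_eq_0_iff:
  assumes "nonconstant g"
  shows "f \<circ>\<^sub>r g = 0 \<longleftrightarrow> f = 0"
  using subst_poly_nonzero[OF assms, of "numer f"] subst_poly_nonzero[OF assms, of "denom f"]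
  by (auto simp: rat_compose_subst)

lemma rat_compose_eq_iff:
  assumes "nonconstant g"
  shows "f \<circ>\<^sub>r g = h \<circ>\<^sub>r g \<longleftrightarrow> f = h"
  using rat_compose_eq_0_iff[OF assms, of "f - h"] by (simp add: rat_compose_diff[OF assms])

lemma rat_compose_inverse:
  assumes "nonconstant g"
  shows "inverse f \<circ>\<^sub>r g = inverse (f \<circ>\<^sub>r g)"
proof (cases "f = 0")
  case False
  then have "(f \<circ>\<^sub>r g) * (inverse f \<circ>\<^sub>r g) = 1"
    using rat_compose_mult[OF assms, of f "inverse f"] by simp
  then show ?thesis by (metis inverse_unique)
qed simp

lemma rat_compose_divide:
  assumes "nonconstant g"
  shows "(f / h) \<circ>\<^sub>r g = (f \<circ>\<^sub>r g) / (h \<circ>\<^sub>r g)"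
  by (simp add: divide_inverse rat_compose_mult[OF assms] rat_compose_inverse[OF assms])

lemma rat_compose_power:
  assumes "nonconstant g"
  shows "(f ^ k) \<circ>\<^sub>r g = (f \<circ>\<^sub>r g) ^ k"
  by (induction k) (simp_all add: rat_compose_mult[OF assms])

lemma rat_compose_power_int:
  assumes "nonconstant g"
  shows "(f powi k) \<circ>\<^sub>r g = (f \<circ>\<^sub>r g) powi k"
  by (simp add: power_int_def rat_compose_power[OF assms] rat_compose_inverse[OF assms])

lemma nonconstant_composeD:
  assumes "nonconstant (f \<circ>\<^sub>r g)"
  shows "nonconstant f"
  using assms rat_compose_rconst unfolding nonconstant_def by (metis imageE rangeI)

lemma rat_compose_assoc:
  assumes g: "nonconstant g" and h: "nonconstant h"
  shows "(f \<circ>\<^sub>r g) \<circ>\<^sub>r h = f \<circ>\<^sub>r (g \<circ>\<^sub>r h)"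
proof -
  have "subst_poly p g \<circ>\<^sub>r h = subst_poly p (g \<circ>\<^sub>r h)" for p
    by (induction p) (simp_all add: rat_compose_add[OF h] rat_compose_mult[OF h])
  then show ?thesis
    by (simp add: rat_compose_subst[of f] rat_compose_divide[OF h])
qed

section \<open>Values on the sphere\<close>

text \<open>
  Evaluation at $a$ as a homomorphism on the local ring of functions regular at $a$. The
  fraction is not assumed reduced, so that closure under sums and products is immediate.
\<close>

definition has_value :: "ratfun \<Rightarrow> complex \<Rightarrow> complex \<Rightarrow> bool" where
  "has_value f a b \<longleftrightarrow>
     (\<exists>p q. poly q a \<noteq> 0 \<and> f = to_fract p / to_fract q \<and> poly p a = b * poly q a)"

lemma has_value_rconst: "has_value (rconst c) a c"
  unfolding has_value_def by (rule exI[of _ "[:c:]"], rule exI[of _ 1]) (simp add: rconst_def)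

lemma has_value_zvar: "has_value zvar a a"
  unfolding has_value_def by (rule exI[of _ "[:0, 1:]"], rule exI[of _ 1]) (simp add: zvar_def)

lemma has_value_add:
  assumes "has_value f a x" "has_value g a y"
  shows "has_value (f + g) a (x + y)"
proof -
  obtain p q p' q' where *: "poly q a \<noteq> 0" "f = to_fract p / to_fract q" "poly p a = x * poly q a"
    "poly q' a \<noteq> 0" "g = to_fract p' / to_fract q'" "poly p' a = y * poly q' a"
    using assms unfolding has_value_def by blast
  have "q \<noteq> 0" "q' \<noteq> 0" using * by auto
  then have "f + g = to_fract (p * q' + p' * q) / to_fract (q * q')"
    using * by (simp add: field_simps)
  moreover have "poly (p * q' + p' * q) a = (x + y) * poly (q * q') a"
    using * by (simp add: algebra_simps)
  ultimately show ?thesis unfolding has_value_def using * by (metis mult_eq_0_iff poly_mult)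
qed

lemma has_value_mult:
  assumes "has_value f a x" "has_value g a y"
  shows "has_value (f * g) a (x * y)"
proof -
  obtain p q p' q' where *: "poly q a \<noteq> 0" "f = to_fract p / to_fract q" "poly p a = x * poly q a"
    "poly q' a \<noteq> 0" "g = to_fract p' / to_fract q'" "poly p' a = y * poly q' a"
    using assms unfolding has_value_def by blast
  then have "f * g = to_fract (p * p') / to_fract (q * q')" by simp
  moreover have "poly (p * p') a = (x * y) * poly (q * q') a"
    using * by (simp add: algebra_simps)
  ultimately show ?thesis unfolding has_value_def using * by (metis mult_eq_0_iff poly_mult)
qed

lemma has_value_inverse:
  assumes "has_value f a x" "x \<noteq> 0"
  shows "has_value (inverse f) a (inverse x)"
proof -
  obtain p q where *: "poly q a \<noteq> 0" "f = to_fract p / to_fract q" "poly p a = x * poly q a"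
    using assms unfolding has_value_def by blast
  then show ?thesis unfolding has_value_def using assms(2)
    by (intro exI[of _ q] exI[of _ p]) (simp add: field_simps)
qed

lemma has_value_power: "has_value f a x \<Longrightarrow> has_value (f ^ k) a (x ^ k)"
  by (induction k) (use has_value_rconst[of 1] has_value_mult in auto)

lemma value_at_quot:
  assumes "f = to_fract p / to_fract q" "q \<noteq> 0" "\<not> (poly p a = 0 \<and> poly q a = 0)"
  shows "value_at f a = (if poly q a = 0 then Infty else Pt (poly p a / poly q a))"
proof -
  have "p * denom f = numer f * q"
    using assms(1,2) by (rule quot_cross_multiply)
  then have eq: "poly p a * poly (denom f) a = poly (numer f) a * poly q a"
    by (metis poly_mult)
  have "poly (numer f) a \<noteq> 0 \<or> poly (denom f) a \<noteq> 0"
    using coprime_numer_denom[of f] coprime_poly_0 by blast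
  then have "poly (denom f) a = 0 \<longleftrightarrow> poly q a = 0" using eq assms(3) by auto
  then show ?thesis using eq by (simp add: value_at_def field_simps)
qed

lemma has_value_value_at:
  assumes "has_value f a b"
  shows "value_at f a = Pt b"
proof -
  obtain p q where *: "poly q a \<noteq> 0" "f = to_fract p / to_fract q" "poly p a = b * poly q a"
    using assms unfolding has_value_def by blast
  moreover from * have "q \<noteq> 0" by auto
  ultimately show ?thesis using value_at_quot[of f p q a] by simp
qed

lemma value_at_Pt_iff: "value_at f a = Pt b \<longleftrightarrow> has_value f a b"
proof
  assume "value_at f a = Pt b"
  then have "poly (denom f) a \<noteq> 0" "b = poly (numer f) a / poly (denom f) a"
    by (auto simp: value_at_def split: if_splits)
  then show "has_value f a b"
    unfolding has_value_def
    by (intro exI[of _ "numer f"] exI[of _ "denom f"]) (use ratfun_quot[of f] in auto)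
qed (rule has_value_value_at)

lemma value_at_Infty_iff: "value_at f a = Infty \<longleftrightarrow> f \<noteq> 0 \<and> has_value (inverse f) a 0"
proof
  assume "value_at f a = Infty"
  then have d: "poly (denom f) a = 0" by (auto simp: value_at_def split: if_splits)
  then have n: "poly (numer f) a \<noteq> 0"
    using coprime_numer_denom[of f] coprime_poly_0 by blast
  have "inverse f = to_fract (denom f) / to_fract (numer f)"
    by (subst ratfun_quot[of f]) simp
  then have "has_value (inverse f) a 0"
    unfolding has_value_def using d n by auto
  then show "f \<noteq> 0 \<and> has_value (inverse f) a 0" using n by auto
next
  assume *: "f \<noteq> 0 \<and> has_value (inverse f) a 0"
  then obtain p q where pq: "poly q a \<noteq> 0" "inverse f = to_fract p / to_fract q" "poly p a = 0"
    unfolding has_value_def by auto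
  have "f = inverse (inverse f)" by simp
  also have "\<dots> = to_fract q / to_fract p" unfolding pq by simp
  finally have f: "f = to_fract q / to_fract p" .
  with * have "p \<noteq> 0" by auto
  with value_at_quot[OF f] pq show "value_at f a = Infty" by simp
qed

lemma has_value_subst_poly:
  assumes "has_value g a b"
  shows "has_value (subst_poly p g) a (poly p b)"
  using assms
  by (induction p) (use has_value_rconst[of 0] in \<open>auto intro: has_value_add has_value_mult has_value_rconst\<close>)

text \<open>
  If $g(a) = b$ is finite, then substituting $g$ into the reduced numerator and denominator
  of $f$ gives values at $a$ that are not both zero, so $f \circ g$ has no indeterminacy at $a$.
\<close>

lemma value_at_compose:
  assumes "nonconstant g" "value_at g a = Pt b"
  shows "value_at (f \<circ>\<^sub>r g) a = value_at f b"
proof -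
  have g: "has_value g a b" using assms(2) by (simp add: value_at_Pt_iff)
  note n = has_value_subst_poly[OF g, of "numer f"] and d = has_value_subst_poly[OF g, of "denom f"]
  show ?thesis
  proof (cases "poly (denom f) b = 0")
    case False
    have "has_value (f \<circ>\<^sub>r g) a (poly (numer f) b * inverse (poly (denom f) b))"
      unfolding rat_compose_subst divide_inverse using n d False
      by (intro has_value_mult has_value_inverse)
    then show ?thesis using False
      by (simp add: has_value_value_at) (simp add: value_at_def divide_inverse)
  next
    case True
    then have nz: "poly (numer f) b \<noteq> 0"
      using coprime_numer_denom[of f] coprime_poly_0 by blast
    have "has_value (subst_poly (denom f) g * inverse (subst_poly (numer f) g)) a
        (poly (denom f) b * inverse (poly (numer f) b))"
      using n d nz by (intro has_value_mult has_value_inverse)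
    moreover have "inverse (f \<circ>\<^sub>r g) = subst_poly (denom f) g * inverse (subst_poly (numer f) g)"
      by (simp add: rat_compose_subst field_simps)
    ultimately have "has_value (inverse (f \<circ>\<^sub>r g)) a 0" using True by simp
    moreover have "f \<circ>\<^sub>r g \<noteq> 0"
      using nz rat_compose_eq_0_iff[OF assms(1), of f] by (metis numer_0 poly_0)
    ultimately have "value_at (f \<circ>\<^sub>r g) a = Infty" by (simp add: value_at_Infty_iff)
    then show ?thesis using True by (simp add: value_at_def)
  qed
qed

primrec sphere_power :: "sphere \<Rightarrow> nat \<Rightarrow> sphere" where
  "sphere_power (Pt a) k = Pt (a ^ k)"
| "sphere_power Infty k = Infty"

lemma value_at_power:
  assumes "k > 0"
  shows "value_at (f ^ k) a = sphere_power (value_at f a) k"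
proof (cases "value_at f a")
  case (Pt b)
  then have "has_value (f ^ k) a (b ^ k)" by (simp add: value_at_Pt_iff has_value_power)
  then show ?thesis using Pt by (simp add: has_value_value_at)
next
  case Infty
  then have "f \<noteq> 0" "has_value (inverse f ^ k) a (0 ^ k)"
    using has_value_power by (auto simp: value_at_Infty_iff)
  then have "value_at (f ^ k) a = Infty" using assms by (simp add: value_at_Infty_iff power_inverse zero_power)
  then show ?thesis using Infty by simp
qed

lemma value_at_rconst_mult:
  assumes "value_at f a = Pt b"
  shows "value_at (rconst c * f) a = Pt (c * b)"
  using assms by (simp add: value_at_Pt_iff has_value_mult has_value_rconst)

lemma nonconstant_inverse_zvar: "nonconstant (inverse zvar)"
  using nonconstant_inverse nonconstant_zvar_power[of 1] by simp

lemma rat_map_zvar_power: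
  assumes "k > 0"
  shows "rat_map (zvar ^ k) x = sphere_power x k"
proof (cases x)
  case (Pt a)
  then show ?thesis
    by (simp add: value_at_Pt_iff has_value_power has_value_zvar)
next
  case Infty
  have "value_at (inverse zvar) 0 = Infty"
    by (simp add: value_at_Infty_iff has_value_zvar)
  then show ?thesis using Infty assms
    by (simp add: rat_compose_power[OF nonconstant_inverse_zvar] value_at_power)
qed

section \<open>Orders of vanishing\<close>

lemma order_at_quot:
  assumes "f = to_fract p / to_fract q" "p \<noteq> 0" "q \<noteq> 0"
  shows "order_at a f = int (order a p) - int (order a q)"
proof -
  have eq: "p * denom f = numer f * q"
    using assms(1,3) by (rule quot_cross_multiply)
  have "f \<noteq> 0" using assms by simp
  then have "p * denom f \<noteq> 0" "numer f * q \<noteq> 0" using assms by simp_all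
  then have "order a p + order a (denom f) = order a (numer f) + order a q"
    using eq by (metis order_mult)
  then show ?thesis by (simp add: order_at_def)
qed

lemma order_at_mult:
  assumes "f \<noteq> 0" "g \<noteq> 0"
  shows "order_at a (f * g) = order_at a f + order_at a g"
proof -
  have "f * g = to_fract (numer f * numer g) / to_fract (denom f * denom g)"
    by (subst (1) ratfun_quot[of f], subst (1) ratfun_quot[of g]) simp
  moreover have "numer f * numer g \<noteq> 0" "denom f * denom g \<noteq> 0" using assms by simp_all
  ultimately have "order_at a (f * g) =
      int (order a (numer f * numer g)) - int (order a (denom f * denom g))"
    by (rule order_at_quot)
  then show ?thesis
    using assms by (simp add: order_mult order_at_def)
qed

lemma order_at_1 [simp]: "order_at a 1 = 0"
  by (simp add: order_at_def numer_def denom_def)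

lemma order_at_inverse: "f \<noteq> 0 \<Longrightarrow> order_at a (inverse f) = - order_at a f"
  using order_at_mult[of f "inverse f" a] by simp

lemma order_at_power: "f \<noteq> 0 \<Longrightarrow> order_at a (f ^ k) = int k * order_at a f"
  by (induction k) (simp_all add: order_at_mult algebra_simps)

lemma order_at_power_int: "f \<noteq> 0 \<Longrightarrow> order_at a (f powi k) = k * order_at a f"
  by (simp add: power_int_def order_at_power order_at_inverse)

lemma order_at_zvar: "order_at 0 zvar = 1"
proof -
  have "order 0 [:0, 1 :: complex:] = 1"
    using order_0_monom[of "1::complex" 1] by (simp add: monom_altdef)
  then show ?thesis by (simp add: order_at_def zvar_def)
qed

lemma order_numer_or_denom: "order a (numer f) = 0 \<or> order a (denom f) = 0"
proof -
  have "poly (numer f) a \<noteq> 0 \<or> poly (denom f) a \<noteq> 0"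
    using coprime_numer_denom[of f] coprime_poly_0 by blast
  then show ?thesis using order_0I[of "numer f" a] order_0I[of "denom f" a] by metis
qed

lemma value_at_order_at:
  assumes "f \<noteq> 0"
  shows "value_at f a = Pt 0 \<longleftrightarrow> order_at a f > 0"
    and "value_at f a = Infty \<longleftrightarrow> order_at a f < 0"
proof -
  have num: "poly (numer f) a = 0 \<longleftrightarrow> order a (numer f) \<noteq> 0"
    and den: "poly (denom f) a = 0 \<longleftrightarrow> order a (denom f) \<noteq> 0"
    using assms by (simp_all add: order_root)
  show "value_at f a = Pt 0 \<longleftrightarrow> order_at a f > 0" "value_at f a = Infty \<longleftrightarrow> order_at a f < 0"
    using order_numer_or_denom[of a f] by (auto simp: value_at_def order_at_def num den)
qed

lemma complex_nth_root_ex: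
  assumes "n > 0"
  shows "\<exists>x. x ^ n = (c :: complex)"
proof -
  have "degree (monom 1 n + [:- c:]) = n"
    using assms by (subst degree_add_eq_left) (simp_all add: degree_monom_eq)
  then obtain x where "poly (monom 1 n + [:- c:]) x = 0"
    using fundamental_theorem_of_algebra_alt[of "monom 1 n + [:- c:]"] assms
    by (metis degree_pCons_0 less_numeral_extra(3))
  then show ?thesis by (auto simp: poly_monom)
qed

section \<open>Powers up to a monomial, and minimal maps\<close>

text \<open>
  In the factorization of $p$ into linear factors, those with nonzero root group into $n$-th
  powers, and the leading coefficient has a complex $n$-th root.
\<close>

lemma poly_eq_monom_times_nth_power:
  fixes p :: "complex poly"
  assumes "p \<noteq> 0" "n > 0" "\<And>a. a \<noteq> 0 \<Longrightarrow> n dvd order a p"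
  obtains s where "p = monom 1 (order 0 p) * s ^ n"
proof -
  obtain c where c: "c ^ n = lead_coeff p" using complex_nth_root_ex assms(2) by blast
  define s where "s = smult c (\<Prod>a | poly p a = 0 \<and> a \<noteq> 0. [:-a, 1:] ^ (order a p div n))"
  have s: "s ^ n = smult (lead_coeff p) (\<Prod>a | poly p a = 0 \<and> a \<noteq> 0. [:-a, 1:] ^ order a p)"
    using assms(3)
    by (auto simp: s_def smult_power c prod_power_distrib simp flip: power_mult intro!: prod.cong)
  have fin: "finite {a. poly p a = 0}" using assms(1) by (rule poly_roots_finite)
  have "(\<Prod>a | poly p a = 0. [:-a, 1:] ^ order a p) =
      monom 1 (order 0 p) * (\<Prod>a | poly p a = 0 \<and> a \<noteq> 0. [:-a, 1:] ^ order a p)"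
  proof (cases "poly p 0 = 0")
    case True
    then have "{a. poly p a = 0} = insert 0 {a. poly p a = 0 \<and> a \<noteq> 0}" by auto
    then show ?thesis using fin
      by (simp add: monom_altdef del: Collect_conj_eq)
  next
    case False
    then have "{a. poly p a = 0 \<and> a \<noteq> 0} = {a. poly p a = 0}" by auto
    moreover have "order 0 p = 0" using False by (rule order_0I)
    ultimately show ?thesis by simp
  qed
  then have "p = monom 1 (order 0 p) * s ^ n"
    using complex_poly_decompose[of p] by (simp add: s)
  then show ?thesis by (rule that)
qed

text \<open>
  Zeros and poles do not interfere: the reduced numerator and denominator have no common
  root, so $n$ divides the order of both of them at each nonzero point.
\<close>

lemma ratfun_eq_zvar_times_nth_power:
  assumes "f \<noteq> 0" "n > 0" "\<And>a. a \<noteq> 0 \<Longrightarrow> int n dvd order_at a f"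
  obtains R where "f = zvar powi order_at 0 f * R ^ n"
proof -
  have dvd: "n dvd order a (numer f) \<and> n dvd order a (denom f)" if "a \<noteq> 0" for a
    using assms(3)[OF that] order_numer_or_denom[of a f]
    by (auto simp: order_at_def)
  obtain s where s: "numer f = monom 1 (order 0 (numer f)) * s ^ n"
    using poly_eq_monom_times_nth_power[of "numer f" n] assms dvd by auto
  obtain t where t: "denom f = monom 1 (order 0 (denom f)) * t ^ n"
    using poly_eq_monom_times_nth_power[of "denom f" n] assms dvd by auto
  have "f = to_fract (numer f) / to_fract (denom f)" by (rule ratfun_quot)
  also have "\<dots> = zvar powi order_at 0 f * (to_fract s / to_fract t) ^ n"
    by (subst s, subst t)
       (simp add: order_at_def power_int_diff to_fract_power power_divide flip: zvar_power)
  finally show ?thesis by (rule that)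
qed

text \<open>
  The points $0$ and $\infty$ of the sphere are the only ones of weight $n$. So minimality at
  a nonzero zero or pole $a$ reads $n = \gcd(m, n)$ for its multiplicity $m$, and minimality at $0$
  forces the weight $n$ at $A(0)$ together with $\gcd(m, n) = 1$.
\<close>

lemma minimal_map_zvar_times_nth_power:
  assumes n: "n \<ge> 2" and A: "minimal_holomorphic_map (orbifold_0_infty n) A"
  shows "\<exists>R r. coprime r (int n) \<and> A = zvar powi r * R ^ n"
proof -
  have A0: "A \<noteq> 0"
    using A nonconstant_nonzero unfolding minimal_holomorphic_map_def by blast
  have eq: "orbifold_0_infty n (value_at A a) =
      orbifold_0_infty n (Pt a) * gcd (local_degree_at A a) (orbifold_0_infty n (value_at A a))" for a
  proof -
    have "orbifold_0_infty n (rat_map A (Pt a)) = orbifold_0_infty n (Pt a) *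
        gcd (local_degree A (Pt a)) (orbifold_0_infty n (rat_map A (Pt a)))"
      using A unfolding minimal_holomorphic_map_def by blast
    then show ?thesis by (simp only: rat_map.simps local_degree.simps)
  qed
  have deg: "local_degree_at A a = nat \<bar>order_at a A\<bar>" and val: "orbifold_0_infty n (value_at A a) = n"
    if "order_at a A \<noteq> 0" for a
  proof -
    have "value_at A a = Pt 0 \<or> value_at A a = Infty"
      using that value_at_order_at[OF A0] by (metis linorder_neqE)
    then show "local_degree_at A a = nat \<bar>order_at a A\<bar>" "orbifold_0_infty n (value_at A a) = n"
      using value_at_order_at[OF A0, of a]
      by (auto simp: local_degree_at_def orbifold_0_infty_def)
  qed
  have "int n dvd order_at a A" if "a \<noteq> 0" for a
  proof (cases "order_at a A = 0")
    case False
    then have "n = gcd (nat \<bar>order_at a A\<bar>) n"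
      using eq[of a] deg val that by (simp add: orbifold_0_infty_def)
    then show ?thesis by (metis gcd_dvd1 int_dvd_int_iff nat_0_le abs_ge_zero dvd_abs_iff)
  qed simp
  then obtain R where R: "A = zvar powi order_at 0 A * R ^ n"
    using ratfun_eq_zvar_times_nth_power[OF A0, of n] n by auto
  have eq0: "orbifold_0_infty n (value_at A 0) =
      n * gcd (local_degree_at A 0) (orbifold_0_infty n (value_at A 0))"
    using eq[of 0] by (simp add: orbifold_0_infty_def)
  have "order_at 0 A \<noteq> 0"
  proof
    assume "order_at 0 A = 0"
    then have "value_at A 0 \<noteq> Pt 0" "value_at A 0 \<noteq> Infty"
      using value_at_order_at[OF A0] by simp_all
    then show False using eq0 n by (simp add: orbifold_0_infty_def)
  qed
  then have "gcd (nat \<bar>order_at 0 A\<bar>) n = 1"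
    using eq0 deg val n by simp
  then have "coprime (order_at 0 A) (int n)"
    by (metis coprime_abs_left_iff coprime_iff_gcd_eq_1 coprime_int_iff nat_0_le abs_ge_zero)
  then show ?thesis using R by blast
qed

text \<open>
  The order at $0$ is congruent to $r$ modulo $n$, hence nonzero.
\<close>

lemma value_at_0_zvar_times_nth_power:
  assumes "n \<ge> 2" "coprime r (int n)" "A = zvar powi r * R ^ n" "A \<noteq> 0"
  shows "value_at A 0 = Pt 0 \<or> value_at A 0 = Infty"
proof -
  have "R \<noteq> 0" using assms by auto
  then have ord: "order_at 0 A = r + int n * order_at 0 R"
    by (simp add: assms(3) order_at_mult order_at_power_int order_at_power order_at_zvar)
  have "order_at 0 A \<noteq> 0"
  proof
    assume "order_at 0 A = 0"
    then have "r = int n * (- order_at 0 R)" using ord by simp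
    then have "int n dvd r" by simp
    then show False using assms(1,2) by (metis coprime_common_divisor dvd_refl int_dvd_int_iff nat_dvd_1_iff_1 numeral_eq_one_iff of_nat_1 One_nat_def Suc_1 not_less_eq_eq order_refl)
  qed
  then show ?thesis using value_at_order_at[OF assms(4)] by auto
qed

lemma pcompose_monom_monom: "pcompose (monom c j) (monom 1 n) = monom (c :: complex) (n * j)"
  by (induction j) (simp_all add: monom_0 monom_Suc pcompose_pCons mult_monom)

section \<open>Functions whose power is invariant under rotation\<close>

lemma cis_root_power_eq_imp_cong:
  assumes "n > 0" "cis (2 * pi / real n) ^ j = cis (2 * pi / real n) ^ k"
  shows "j mod n = k mod n"
proof -
  define z where "z = cis (2 * pi / real n)"
  have pow: "z ^ k = cis (2 * pi * real k / real n)" for k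
    by (simp add: z_def DeMoivre mult_ac)
  have "z ^ n = 1" using assms(1) by (simp add: pow)
  then have mod: "z ^ k = z ^ (k mod n)" for k
    by (metis mult_1 div_mult_mod_eq mult.commute power_add power_mult power_one)
  have "z ^ (j mod n) = z ^ (k mod n)" using assms(2) mod z_def by metis
  moreover have "inj_on (\<lambda>k. z ^ k) {..<n}"
    using bij_betw_roots_unity[OF assms(1)] by (simp add: pow bij_betw_def)
  ultimately show ?thesis using assms(1) by (auto simp: inj_on_def)
qed

text \<open>
  Comparing coefficients in $u(\zeta z) = e\,u(z)$ gives $\zeta^k = e$ whenever the
  coefficient of $z^k$ is nonzero, so these $k$ are all congruent modulo $n$. The exponent $r$ is the
  smallest of them.
\<close>

lemma rotation_eigenpoly:
  fixes u :: "complex poly"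
  assumes n: "n > 0" and u: "u \<noteq> 0"
    and eigen: "pcompose u [:0, cis (2 * pi / real n):] = smult e u"
  obtains r u1 where "u = monom 1 r * pcompose u1 (monom 1 n)"
proof -
  define z where "z = cis (2 * pi / real n)"
  define r where "r = (LEAST k. coeff u k \<noteq> 0)"
  have "\<exists>k. coeff u k \<noteq> 0" using u by (metis leading_coeff_0_iff)
  then have r: "coeff u r \<noteq> 0" unfolding r_def by (rule LeastI_ex)
  have exps: "\<exists>j \<le> degree u. k = r + n * j" if "coeff u k \<noteq> 0" for k
  proof -
    have "z ^ i * coeff u i = e * coeff u i" for i
      using arg_cong[OF eigen, of "\<lambda>p. coeff p i"] by (simp add: coeff_pcompose_linear z_def)
    then have "z ^ k = e" "z ^ r = e" using that r by (metis mult_right_cancel)+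
    then have "k mod n = r mod n" using cis_root_power_eq_imp_cong[OF n, of k r] z_def by simp
    moreover have "r \<le> k" unfolding r_def by (rule Least_le) fact
    ultimately obtain j where j: "k = r + n * j"
      by (metis le_add_diff_inverse mod_eq_dvd_iff_nat dvd_def)
    then have "j \<le> k" using n by (cases n) auto
    moreover have "k \<le> degree u" using that by (rule le_degree)
    ultimately have "j \<le> degree u" using j by simp
    then show ?thesis using j by blast
  qed
  define u1 where "u1 = (\<Sum>j\<le>degree u. monom (coeff u (r + n * j)) j)"
  have "monom 1 r * pcompose u1 (monom 1 n) = (\<Sum>j\<le>degree u. monom (coeff u (r + n * j)) (r + n * j))"
    by (simp add: u1_def pcompose_sum pcompose_monom_monom sum_distrib_left mult_monom)
  also have "\<dots> = u"
  proof (rule poly_eqI)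
    fix k
    have "(\<Sum>j\<le>degree u. if r + n * j = k then coeff u (r + n * j) else 0) = coeff u k"
    proof (cases "coeff u k = 0")
      case True
      then show ?thesis by (auto intro!: sum.neutral)
    next
      case False
      then obtain j where j: "j \<le> degree u" "k = r + n * j" using exps by blast
      then have "(\<Sum>i\<le>degree u. if r + n * i = k then coeff u (r + n * i) else 0) =
          (\<Sum>i\<le>degree u. if j = i then coeff u k else 0)"
        using n by (intro sum.cong) auto
      then show ?thesis using j by simp
    qed
    then show "coeff (\<Sum>j\<le>degree u. monom (coeff u (r + n * j)) (r + n * j)) k = coeff u k"
      by (simp add: coeff_sum)
  qed
  finally show ?thesis using that by metis
qed

text \<open>
  Substitution carries a Bezout identity to a Bezout identity.
\<close>

lemma coprime_pcompose:
  fixes p q r :: "complex poly"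
  assumes "coprime p q"
  shows "coprime (pcompose p r) (pcompose q r)"
proof -
  obtain x y where "x * p + y * q = 1"
    using bezout_coefficients_fst_snd[of p q] assms by (metis coprime_iff_gcd_eq_1)
  then have eq: "pcompose x r * pcompose p r + pcompose y r * pcompose q r = 1"
    by (metis pcompose_1 pcompose_add pcompose_mult)
  show ?thesis
  proof (rule coprimeI)
    fix d assume "d dvd pcompose p r" "d dvd pcompose q r"
    then have "d dvd pcompose x r * pcompose p r + pcompose y r * pcompose q r" by simp
    then show "is_unit d" using eq by simp
  qed
qed

text \<open>
  Write $F = u/v$ in lowest terms. Invariance of $F^n$ under the rotation reads
  $u(z)^n v(\zeta z)^n = u(\zeta z)^n v(z)^n$. By coprimality $u(z)^n$ divides $u(\zeta z)^n$, so
  $u(z)$ divides $u(\zeta z)$; the degrees agree, so $u$ is an eigenvector of the rotation, and so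
  is $v$.
\<close>

lemma nth_power_in_zvar_power_imp_form:
  assumes n: "n > 0" and F: "F \<noteq> 0" and eq: "A \<circ>\<^sub>r (zvar ^ n) = F ^ n"
  obtains r R where "F = zvar powi r * (R \<circ>\<^sub>r (zvar ^ n))"
proof -
  define z where "z = cis (2 * pi / real n)"
  define rot where "rot p = pcompose p [:0, z:]" for p
  define u v where "u = numer F" and "v = denom F"
  define a b where "a = pcompose (numer A) (monom 1 n)" and "b = pcompose (denom A) (monom 1 n)"
  have z: "z ^ n = 1" using n by (simp add: z_def DeMoivre)
  have "z \<noteq> 0" by (simp add: z_def)
  have rot: "rot (p * q) = rot p * rot q" "rot (p ^ k) = rot p ^ k" "degree (rot p) = degree p" for p q k
    using \<open>z \<noteq> 0\<close> by (induction k) (simp_all add: rot_def pcompose_mult pcompose_1 degree_pcompose)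
  have "rot (monom 1 n) = monom 1 n"
    by (rule poly_eqI) (auto simp: rot_def coeff_pcompose_linear z)
  then have ab: "rot a = a" "rot b = b"
    unfolding a_def b_def rot_def pcompose_assoc[symmetric] by simp_all
  have nc: "nonconstant (zvar ^ n)" using n by (rule nonconstant_zvar_power)
  have "b \<noteq> 0" using subst_poly_nonzero[OF nc, of "denom A"]
    by (auto simp: b_def zvar_power subst_poly_to_fract)
  have "v \<noteq> 0" "u \<noteq> 0" using F by (simp_all add: u_def v_def)
  have "to_fract a / to_fract b = to_fract (u ^ n) / to_fract (v ^ n)"
  proof -
    have "to_fract (u ^ n) / to_fract (v ^ n) = F ^ n"
      by (subst ratfun_quot[of F]) (simp only: u_def v_def to_fract_power power_divide)
    also have "\<dots> = to_fract a / to_fract b"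
      unfolding eq[symmetric] by (simp only: a_def b_def zvar_power rat_compose_subst subst_poly_to_fract)
    finally show ?thesis by (rule sym)
  qed
  then have "to_fract (a * v ^ n) = to_fract (u ^ n * b)"
    using \<open>b \<noteq> 0\<close> \<open>v \<noteq> 0\<close> by (subst (asm) frac_eq_eq) simp_all
  then have e1: "a * v ^ n = u ^ n * b" by (simp only: to_fract_eq_iff)
  then have "rot (a * v ^ n) = rot (u ^ n * b)" by (rule arg_cong)
  then have e2: "a * rot v ^ n = rot u ^ n * b" by (simp only: rot ab)
  have "b * (u ^ n * rot v ^ n) = (u ^ n * b) * rot v ^ n" by (simp only: mult_ac)
  also have "\<dots> = (a * rot v ^ n) * v ^ n" unfolding e1[symmetric] by (simp only: mult_ac)
  also have "\<dots> = b * (rot u ^ n * v ^ n)" unfolding e2 by (simp only: mult_ac)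
  finally have "b * (u ^ n * rot v ^ n) = b * (rot u ^ n * v ^ n)" .
  then have e3: "u ^ n * rot v ^ n = rot u ^ n * v ^ n" using \<open>b \<noteq> 0\<close> by simp
  have cop: "coprime u v" unfolding u_def v_def by (rule coprime_numer_denom)
  then have "coprime (rot u) (rot v)" unfolding rot_def by (rule coprime_pcompose)
  then have "coprime (u ^ n) (v ^ n)" "coprime (rot u ^ n) (rot v ^ n)" using cop by simp_all
  moreover have "u ^ n dvd rot u ^ n * v ^ n" "v ^ n dvd u ^ n * rot v ^ n"
    by (metis e3 dvd_triv_left, metis e3 dvd_triv_right)
  ultimately have "u ^ n dvd rot u ^ n" "v ^ n dvd rot v ^ n"
    by (simp_all add: coprime_dvd_mult_left_iff coprime_dvd_mult_right_iff coprime_commute)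
  then have "u dvd rot u" "v dvd rot v" using n by simp_all
  moreover have "\<exists>e. rot p = smult e p" if p: "p dvd rot p" "p \<noteq> 0" for p
  proof -
    obtain k where k: "rot p = p * k" using p by (elim dvdE)
    show ?thesis
    proof (cases "k = 0")
      case False
      then have "degree k = 0" using rot(3)[of p] k p by (simp add: degree_mult_eq)
      then obtain c where "k = [:c:]" by (metis degree_eq_zeroE)
      then show ?thesis using k by auto
    qed (use k in auto)
  qed
  ultimately obtain e e' where "rot u = smult e u" "rot v = smult e' v"
    using \<open>u \<noteq> 0\<close> \<open>v \<noteq> 0\<close> by blast
  then obtain r s u1 v1 where uv: "u = monom 1 r * pcompose u1 (monom 1 n)"
      "v = monom 1 s * pcompose v1 (monom 1 n)"
    using rotation_eigenpoly[OF n \<open>u \<noteq> 0\<close>] rotation_eigenpoly[OF n \<open>v \<noteq> 0\<close>]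
    unfolding rot_def z_def by metis
  then have "v1 \<noteq> 0" using \<open>v \<noteq> 0\<close> by auto
  have "F = to_fract u / to_fract v" unfolding u_def v_def by (rule ratfun_quot)
  also have "\<dots> = zvar powi (int r - int s) * ((to_fract u1 / to_fract v1) \<circ>\<^sub>r (zvar ^ n))"
    unfolding rat_compose_quot[OF nc \<open>v1 \<noteq> 0\<close>]
    by (subst uv, subst uv)
       (simp add: power_int_diff zvar_power subst_poly_to_fract)
  finally show ?thesis by (rule that)
qed

section \<open>Injective rational functions and right factors\<close>

text \<open>
  Let $w = u/v$ have degree $d \geq 2$. For all but at most one $c$ the polynomial $u - c v$
  has degree $d$, and injectivity leaves it a single root, which is therefore multiple and so a root
  of the Wronskian $u'v - uv'$. Different $c$ give different roots, so the Wronskian is zero. Then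
  $u$ divides $u'$ and $v$ divides $v'$, which makes both constant.
\<close>

lemma rat_degree_le_1_if_injective:
  assumes inj: "\<And>x y c. value_at w x = Pt c \<Longrightarrow> value_at w y = Pt c \<Longrightarrow> x = y"
  shows "rat_degree w \<le> 1"
proof (rule ccontr)
  assume "\<not> rat_degree w \<le> 1"
  define u v d where "u = numer w" and "v = denom w" and "d = rat_degree w"
  have d: "d \<ge> 2" using \<open>\<not> rat_degree w \<le> 1\<close> d_def by simp
  have dmax: "d = max (degree u) (degree v)" by (simp add: d_def u_def v_def rat_degree_def)
  have cop: "coprime u v" unfolding u_def v_def by (rule coprime_numer_denom)
  define wr where "wr = pderiv u * v - u * pderiv v"
  (* the c for which u - c v keeps the full degree d *)
  define good where "good = {c. coeff u d \<noteq> c * coeff v d}"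
  have "\<exists>x. value_at w x = Pt c \<and> poly wr x = 0" if "c \<in> good" for c
  proof -
    define p where "p = u - smult c v"
    have "coeff p d \<noteq> 0" using that by (simp add: p_def good_def)
    moreover have "degree p \<le> d" unfolding p_def dmax
      by (intro degree_diff_le) (auto intro: order.trans[OF degree_smult_le])
    ultimately have deg: "degree p = d" by (metis le_antisym le_degree)
    have "p \<noteq> 0" using \<open>coeff p d \<noteq> 0\<close> by auto
    obtain x where x: "poly p x = 0"
      using fundamental_theorem_of_algebra_alt[of p] deg d by force
    have val: "value_at w y = Pt c" if y: "poly p y = 0" for y
    proof -
      have "poly u y = c * poly v y" using y by (simp add: p_def)
      moreover from this have "poly v y \<noteq> 0" using cop coprime_poly_0[of u v y] by auto
      ultimately show ?thesis by (simp add: value_at_def flip: u_def v_def)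
    qed
    have "{y. poly p y = 0} = {x}" using val inj x by blast
    then have "p = smult (lead_coeff p) ([:- x, 1:] ^ order x p)"
      using complex_poly_decompose[of p] by simp
    then have "degree p = order x p"
      using \<open>p \<noteq> 0\<close> by (metis degree_linear_power degree_smult_eq leading_coeff_0_iff)
    then have "[:- x, 1:] ^ 2 dvd p" using deg d by (simp add: order_divides)
    then obtain q where "p = [:- x, 1:] ^ 2 * q" by (elim dvdE)
    then have "poly (pderiv p) x = 0" by (simp add: pderiv_mult pderiv_power)
    then have "poly (pderiv u) x = c * poly (pderiv v) x"
      by (simp add: p_def pderiv_diff pderiv_smult)
    moreover have "poly u x = c * poly v x" using x by (simp add: p_def)
    ultimately have "poly wr x = 0" by (simp add: wr_def)
    then show ?thesis using val[OF x] by blast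
  qed
  then obtain x where x: "\<And>c. c \<in> good \<Longrightarrow> value_at w (x c) = Pt c \<and> poly wr (x c) = 0"
    by metis
  have "inj_on x good" by (rule inj_onI) (metis x sphere.inject)
  moreover have "infinite good"
  proof -
    have lc: "coeff u d \<noteq> 0 \<or> coeff v d \<noteq> 0"
      using d dmax by (metis degree_0 leading_coeff_0_iff max_def not_numeral_le_zero)
    have "- good \<subseteq> {coeff u d / coeff v d}"
      using lc by (auto simp: good_def field_simps)
    then have "finite (- good)" using finite_subset by blast
    then show ?thesis using infinite_UNIV_char_0[where 'a = complex] by (metis finite_compl)
  qed
  ultimately have "infinite (x ` good)" by (simp add: finite_image_iff)
  moreover have "x ` good \<subseteq> {y. poly wr y = 0}" using x by auto
  ultimately have "infinite {y. poly wr y = 0}" using finite_subset by blast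
  then have "wr = 0" using poly_roots_finite by blast
  then have eq: "pderiv u * v = u * pderiv v" by (simp add: wr_def)
  have "u dvd pderiv u" "v dvd pderiv v"
    using cop eq by (metis coprime_dvd_mult_left_iff dvd_triv_left, metis coprime_commute coprime_dvd_mult_right_iff dvd_triv_right)
  moreover have "degree p = 0" if "p dvd pderiv p" for p :: "complex poly"
    using that by (metis degree_pderiv dvd_imp_degree_le diff_Suc_1 diff_is_0_eq' gr0_conv_Suc lessI linorder_not_less not_gr0 pderiv_eq_0_iff)
  ultimately show False using d dmax by simp
qed

lemma value_at_inverse_zvar: "a \<noteq> 0 \<Longrightarrow> value_at (inverse zvar) a = Pt (inverse a)"
  by (simp add: value_at_Pt_iff has_value_zvar has_value_inverse)

lemma value_at_compose_inverse_zvar: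
  "a \<noteq> 0 \<Longrightarrow> value_at (f \<circ>\<^sub>r inverse zvar) a = value_at f (inverse a)"
  by (rule value_at_compose[OF nonconstant_inverse_zvar value_at_inverse_zvar])

section \<open>Irreducibility of parametrized curves\<close>

lemma hom_coords_value_at:
  obtains l where "l \<noteq> 0"
    "poly (numer f) a = l * fst (hom_coords (value_at f a))"
    "poly (denom f) a = l * snd (hom_coords (value_at f a))"
proof (cases "poly (denom f) a = 0")
  case True
  then have "poly (numer f) a \<noteq> 0"
    using coprime_numer_denom[of f] coprime_poly_0 by blast
  then show ?thesis using True that[of "poly (numer f) a"] by (simp add: value_at_def)
next
  case False
  then show ?thesis using that[of "poly (denom f) a"] by (simp add: value_at_def)
qed

text \<open>
  The reduced numerators and denominators are homogeneous coordinates of the values up to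
  nonzero factors, and bihomogeneity turns these factors into a single nonzero factor.
\<close>

lemma bihom_eval_along_ratfuns:
  "\<exists>P. \<forall>a. bihom_eval d e c (value_at p a, value_at q a) = 0 \<longleftrightarrow> poly P a = 0"
proof -
  define P where "P = (\<Sum>i\<le>d. \<Sum>j\<le>e. smult (c i j)
    (numer p ^ i * denom p ^ (d - i) * numer q ^ j * denom q ^ (e - j)))"
  have "bihom_eval d e c (value_at p a, value_at q a) = 0 \<longleftrightarrow> poly P a = 0" for a
  proof -
    obtain x0 x1 y0 y1 where x: "hom_coords (value_at p a) = (x0, x1)"
      and y: "hom_coords (value_at q a) = (y0, y1)" by (metis surj_pair)
    obtain l where l: "l \<noteq> 0" "poly (numer p) a = l * x0" "poly (denom p) a = l * x1"
      using hom_coords_value_at[of p a] x by auto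
    obtain m where m: "m \<noteq> 0" "poly (numer q) a = m * y0" "poly (denom q) a = m * y1"
      using hom_coords_value_at[of q a] y by auto
    have "poly P a = (\<Sum>i\<le>d. \<Sum>j\<le>e. c i j *
        ((l * x0) ^ i * (l * x1) ^ (d - i) * (m * y0) ^ j * (m * y1) ^ (e - j)))"
      by (simp add: P_def poly_sum l m)
    also have "\<dots> = (\<Sum>i\<le>d. \<Sum>j\<le>e. (l ^ d * m ^ e) *
        (c i j * x0 ^ i * x1 ^ (d - i) * y0 ^ j * y1 ^ (e - j)))"
    proof (intro sum.cong refl)
      fix i j assume "i \<in> {..d}" "j \<in> {..e}"
      then have "l ^ d = l ^ i * l ^ (d - i)" "m ^ e = m ^ j * m ^ (e - j)"
        by (simp_all flip: power_add)
      then show "c i j * ((l * x0) ^ i * (l * x1) ^ (d - i) * (m * y0) ^ j * (m * y1) ^ (e - j)) =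
          (l ^ d * m ^ e) * (c i j * x0 ^ i * x1 ^ (d - i) * y0 ^ j * y1 ^ (e - j))"
        by (simp add: power_mult_distrib mult_ac)
    qed
    also have "\<dots> = l ^ d * m ^ e * bihom_eval d e c (value_at p a, value_at q a)"
      by (simp add: bihom_eval_def x y sum_distrib_left)
    finally show ?thesis using l m by simp
  qed
  then show ?thesis by (intro exI allI)
qed

text \<open>
  If the given point with nonzero value is $\infty$, then the coordinate $1/z$ produces
  finite points with the same property, so the pulled back polynomial is nonzero in every case.
\<close>

lemma finite_zeros_along_ratfuns:
  assumes nz: "bihom_eval d e c (rat_map p t, rat_map q t) \<noteq> 0"
  shows "finite {a. bihom_eval d e c (value_at p a, value_at q a) = 0}"
proof -
  have fin: "finite {a. bihom_eval d e c (value_at p a, value_at q a) = 0}"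
    if "bihom_eval d e c (value_at p b, value_at q b) \<noteq> 0" for p q b
  proof -
    obtain P where P: "\<forall>a. bihom_eval d e c (value_at p a, value_at q a) = 0 \<longleftrightarrow> poly P a = 0"
      using bihom_eval_along_ratfuns[of d e c p q] ..
    have "poly P b \<noteq> 0" using that unfolding P[rule_format] .
    then have "P \<noteq> 0" by auto
    then show ?thesis unfolding P[rule_format] by (rule poly_roots_finite)
  qed
  show ?thesis
  proof (cases t)
    case (Pt b)
    then show ?thesis using fin[of p b q] nz by simp
  next
    case Infty
    define p' q' where "p' = p \<circ>\<^sub>r inverse zvar" and "q' = q \<circ>\<^sub>r inverse zvar"
    have "finite {a. bihom_eval d e c (value_at p' a, value_at q' a) = 0}"
      using fin[of p' 0 q'] nz Infty by (simp add: p'_def q'_def)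
    then have "infinite (- (insert 0 {a. bihom_eval d e c (value_at p' a, value_at q' a) = 0}))"
      using infinite_UNIV_char_0[where 'a = complex] by (metis finite_compl finite_insert)
    then have "- (insert 0 {a. bihom_eval d e c (value_at p' a, value_at q' a) = 0}) \<noteq> {}"
      by (rule infinite_imp_nonempty)
    then obtain s where "s \<noteq> 0" "bihom_eval d e c (value_at p' s, value_at q' s) \<noteq> 0"
      by auto
    then show ?thesis
      using fin[of p "inverse s" q] by (simp add: p'_def q'_def value_at_compose_inverse_zvar)
  qed
qed

text \<open>
  A closed set that does not contain the curve meets its finite part in finitely many
  parameters only, so two such sets cannot cover it.
\<close>

lemma zariski_irreducible_range:
  "zariski_irreducible (range (\<lambda>t. (rat_map p t, rat_map q t)))" (is "zariski_irreducible (range ?\<phi>)")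
  unfolding zariski_irreducible_def
proof (intro conjI allI impI)
  show "range ?\<phi> \<noteq> {}" by simp
  fix C D assume CD: "zariski_closed C \<and> zariski_closed D \<and> range ?\<phi> \<subseteq> C \<union> D"
  have fin: "finite {a. ?\<phi> (Pt a) \<in> E}" if E: "zariski_closed E" "\<not> range ?\<phi> \<subseteq> E" for E
  proof -
    obtain H where H: "E = {P. \<forall>(d, e, c) \<in> H. bihom_eval d e c P = 0}"
      using E(1) unfolding zariski_closed_def by blast
    then obtain t d e c where h: "(d, e, c) \<in> H" "bihom_eval d e c (?\<phi> t) \<noteq> 0"
      using E(2) by auto
    have "{a. ?\<phi> (Pt a) \<in> E} \<subseteq> {a. bihom_eval d e c (value_at p a, value_at q a) = 0}"
      using h(1) by (auto simp: H)
    then show ?thesis using finite_zeros_along_ratfuns[OF h(2)] finite_subset by blast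
  qed
  show "range ?\<phi> \<subseteq> C \<or> range ?\<phi> \<subseteq> D"
  proof (rule ccontr)
    assume "\<not> (range ?\<phi> \<subseteq> C \<or> range ?\<phi> \<subseteq> D)"
    then have "finite ({a. ?\<phi> (Pt a) \<in> C} \<union> {a. ?\<phi> (Pt a) \<in> D})"
      using fin[of C] fin[of D] CD by blast
    moreover have "{a. ?\<phi> (Pt a) \<in> C} \<union> {a. ?\<phi> (Pt a) \<in> D} = UNIV"
      using CD by blast
    ultimately show False using infinite_UNIV_char_0[where 'a = complex] by metis
  qed
qed

lemma unique_component_if_irreducible:
  assumes "zariski_irreducible S"
  shows "\<exists>!C. is_component C S"
proof (rule ex1I)
  show "is_component S S" unfolding is_component_def
    by (intro conjI allI impI order_refl assms, elim conjE) (rule equalityI)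
  fix C assume "is_component C S"
  then have C: "C \<subseteq> S \<and> zariski_irreducible C \<and>
      (\<forall>D. C \<subseteq> D \<and> D \<subseteq> S \<and> zariski_irreducible D \<longrightarrow> D = C)"
    unfolding is_component_def .
  then have "S = C"
    using C[THEN conjunct2, THEN conjunct2, rule_format, of S] assms by simp
  then show "C = S" by (rule sym)
qed

section \<open>The curve $A(x) = y^n$\<close>

lemma sphere_power_inj:
  assumes "n > 0" "sphere_power x n = sphere_power y n" "y = Pt 0 \<or> y = Infty"
  shows "x = y"
  using assms by (cases x; cases y) (auto simp: zero_power)

lemma sphere_power_eqE:
  assumes "n > 0" "sphere_power x n = sphere_power y n"
  obtains "x = y" | a c where "x = Pt (c * a)" "y = Pt a" "c ^ n = 1"
proof (cases "y = Pt 0 \<or> y = Infty")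
  case True
  then show ?thesis using sphere_power_inj[OF assms] that(1) by blast
next
  case False
  then obtain a where a: "y = Pt a" "a \<noteq> 0" by (cases y) auto
  then obtain b where b: "x = Pt b" "b ^ n = a ^ n" using assms(2) by (cases x) auto
  have "b = (b / a) * a" "(b / a) ^ n = 1" using a b by (simp_all add: power_divide)
  then show ?thesis using that(2) a(1) b(1) by blast
qed

lemma compose_zvar_power_zvar_times_nth_power:
  assumes "n > 0"
  shows "(zvar powi r * R ^ n) \<circ>\<^sub>r (zvar ^ n) = (zvar powi r * (R \<circ>\<^sub>r (zvar ^ n))) ^ n"
proof -
  have nc: "nonconstant (zvar ^ n)" using assms by (rule nonconstant_zvar_power)
  have "(zvar ^ n) powi r = (zvar powi r) ^ n"
    by (simp add: power_int_power power_int_power' mult.commute)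
  then show ?thesis
    by (simp add: rat_compose_mult[OF nc] rat_compose_power_int[OF nc] rat_compose_power[OF nc] power_mult_distrib)
qed

lemma value_at_semiconjugate:
  assumes "n > 0" "A \<circ>\<^sub>r (zvar ^ n) = F ^ n"
  shows "value_at A (a ^ n) = sphere_power (value_at F a) n"
proof -
  have "value_at (zvar ^ n) a = Pt (a ^ n)"
    using rat_map_zvar_power[OF assms(1), of "Pt a"] by simp
  then have "value_at (A \<circ>\<^sub>r (zvar ^ n)) a = value_at A (a ^ n)"
    using nonconstant_zvar_power[OF assms(1)] value_at_compose by blast
  then show ?thesis using assms by (simp add: value_at_power)
qed

text \<open>
  The normal form is preserved by the coordinate change at infinity, with $r$ replaced by
  $-r$. Statements at $\infty$ thereby reduce to statements at $0$.
\<close>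

lemma compose_inverse_zvar_normal_form:
  assumes "n > 0"
  shows "(zvar powi r * R ^ n) \<circ>\<^sub>r inverse zvar = zvar powi (- r) * (R \<circ>\<^sub>r inverse zvar) ^ n"
    and "(zvar powi r * (R \<circ>\<^sub>r (zvar ^ n))) \<circ>\<^sub>r inverse zvar =
           zvar powi (- r) * ((R \<circ>\<^sub>r inverse zvar) \<circ>\<^sub>r (zvar ^ n))"
proof -
  note nc = nonconstant_inverse_zvar nonconstant_zvar_power[OF assms]
  have powi: "inverse zvar powi r = zvar powi (- r)"
    by (simp add: power_int_inverse power_int_minus)
  show "(zvar powi r * R ^ n) \<circ>\<^sub>r inverse zvar = zvar powi (- r) * (R \<circ>\<^sub>r inverse zvar) ^ n"
    by (simp add: rat_compose_mult[OF nc(1)] rat_compose_power_int[OF nc(1)]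
        rat_compose_power[OF nc(1)] powi)
  have "(zvar ^ n) \<circ>\<^sub>r inverse zvar = inverse zvar \<circ>\<^sub>r (zvar ^ n)"
    by (simp add: rat_compose_power[OF nc(1)] rat_compose_inverse[OF nc(2)] power_inverse)
  then have "(R \<circ>\<^sub>r (zvar ^ n)) \<circ>\<^sub>r inverse zvar = (R \<circ>\<^sub>r inverse zvar) \<circ>\<^sub>r (zvar ^ n)"
    by (simp add: rat_compose_assoc nc)
  then show "(zvar powi r * (R \<circ>\<^sub>r (zvar ^ n))) \<circ>\<^sub>r inverse zvar =
      zvar powi (- r) * ((R \<circ>\<^sub>r inverse zvar) \<circ>\<^sub>r (zvar ^ n))"
    by (simp add: rat_compose_mult[OF nc(1)] rat_compose_power_int[OF nc(1)] powi)
qed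

lemma nonconstant_scaling: "w \<noteq> 0 \<Longrightarrow> nonconstant (rconst w * zvar)"
proof -
  assume "w \<noteq> 0"
  moreover have "rconst w * zvar = to_fract [:0, w:]"
    by (simp add: rconst_def zvar_def flip: to_fract_mult)
  ultimately show ?thesis by (simp add: nonconstant_to_fract_iff)
qed

lemma value_at_scaling: "value_at (rconst w * zvar) a = Pt (w * a)"
  unfolding value_at_Pt_iff by (intro has_value_mult has_value_rconst has_value_zvar)

text \<open>
  $R(z^n)$ is fixed by the rotation, so only $z^r$ contributes a factor.
\<close>

lemma rotate_normal_form:
  assumes "n > 0" "w ^ n = 1"
  shows "(zvar powi r * (R \<circ>\<^sub>r (zvar ^ n))) \<circ>\<^sub>r (rconst w * zvar) =
           rconst (w powi r) * (zvar powi r * (R \<circ>\<^sub>r (zvar ^ n)))"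
proof -
  have "w \<noteq> 0" using assms by (auto simp: zero_power)
  then have nc: "nonconstant (rconst w * zvar)" by (rule nonconstant_scaling)
  have "(zvar ^ n) \<circ>\<^sub>r (rconst w * zvar) = zvar ^ n"
    by (simp add: rat_compose_power[OF nc] power_mult_distrib assms(2) flip: rconst_power)
  then have "(R \<circ>\<^sub>r (zvar ^ n)) \<circ>\<^sub>r (rconst w * zvar) = R \<circ>\<^sub>r (zvar ^ n)"
    by (simp add: rat_compose_assoc nc nonconstant_zvar_power[OF assms(1)])
  then show ?thesis
    by (simp add: rat_compose_mult[OF nc] rat_compose_power_int[OF nc] power_int_mult_distrib
        rconst_power_int mult.assoc)
qed

lemma bezout_coprime_int:
  fixes r :: int
  assumes "coprime r (int n)"
  obtains s t where "r * s + int n * t = 1"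
  using bezout_int[of r "int n"] assms that by (metis coprime_iff_gcd_eq_1 mult.commute)

text \<open>
  Over $x = 0$ and $x = \infty$ the fibre has a single point, because $A(x)$ is $0$ or
  $\infty$ there. Over the other points, $y = c F(a)$ with $a^n = x$ and $c^n = 1$. With
  $rs + nt = 1$ and $w = c^s$, rotation by $w$ multiplies $F$ by $w^r = c^{1 - nt} = c$, so
  $F(wa) = y$ while $(wa)^n = x$.
\<close>

lemma fiber_product_parametrized:
  fixes R :: ratfun
  assumes n: "n \<ge> 2" and r: "coprime r (int n)"
    and A: "A = zvar powi r * R ^ n" and F: "F = zvar powi r * (R \<circ>\<^sub>r (zvar ^ n))"
    and A0: "A \<noteq> 0"
  shows "fiber_product A (zvar ^ n) = range (\<lambda>t. (rat_map (zvar ^ n) t, rat_map F t))"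
proof -
  have n0: "n > 0" using n by simp
  define A' F' where "A' = A \<circ>\<^sub>r inverse zvar" and "F' = F \<circ>\<^sub>r inverse zvar"
  define R' where "R' = R \<circ>\<^sub>r inverse zvar"
  have A': "A' = zvar powi (- r) * R' ^ n" and F': "F' = zvar powi (- r) * (R' \<circ>\<^sub>r (zvar ^ n))"
    unfolding A'_def F'_def R'_def A F using compose_inverse_zvar_normal_form[OF n0] by blast+
  have A'0: "A' \<noteq> 0" using A0 by (simp add: A'_def rat_compose_eq_0_iff nonconstant_inverse_zvar)
  have semi: "value_at A (a ^ n) = sphere_power (value_at F a) n"
      "value_at A' (a ^ n) = sphere_power (value_at F' a) n" for a
    unfolding A F A' F'
    by (rule value_at_semiconjugate[OF n0 compose_zvar_power_zvar_times_nth_power[OF n0]])+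
  have image: "rat_map A (rat_map (zvar ^ n) t) = sphere_power (rat_map F t) n" for t
    unfolding rat_map_zvar_power[OF n0] using semi(1) semi(2)[of 0] n0
    by (cases t) (simp_all add: zero_power flip: A'_def F'_def)
  have "\<exists>t. x = sphere_power t n \<and> y = rat_map F t"
    if xy: "rat_map A x = sphere_power y n" for x y
  proof (cases "x = Pt 0 \<or> x = Infty")
    case True
    then have "rat_map A x = Pt 0 \<or> rat_map A x = Infty"
      using value_at_0_zvar_times_nth_power[OF n r A A0]
        value_at_0_zvar_times_nth_power[OF n _ A' A'0] r
      by (auto simp flip: A'_def)
    moreover have x: "x = sphere_power x n" using True n0 by (auto simp: zero_power)
    then have "rat_map A x = sphere_power (rat_map F x) n"
      using image[of x] by (simp add: rat_map_zvar_power n0)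
    ultimately have "y = rat_map F x"
      using xy sphere_power_inj[of n y "rat_map F x"] n0
      by (cases "rat_map F x") auto
    then show ?thesis using x by blast
  next
    case False
    then obtain b where "x = Pt b" by (cases x) auto
    obtain a where "a ^ n = b" using complex_nth_root_ex[OF n0] by blast
    then have x: "x = sphere_power (Pt a) n" using \<open>x = Pt b\<close> by simp
    then have "sphere_power y n = sphere_power (value_at F a) n"
      using xy semi(1)[of a] by simp
    then show ?thesis
    proof (rule sphere_power_eqE[OF n0])
      assume "y = value_at F a"
      then show ?thesis using x by (intro exI[of _ "Pt a"]) simp
    next
      fix f c assume y: "y = Pt (c * f)" and f: "value_at F a = Pt f" and c: "c ^ n = 1"
      obtain s t where st: "r * s + int n * t = 1" using bezout_coprime_int[OF r] by blast
      define w where "w = c powi s"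
      have "c \<noteq> 0" using c n0 by (auto simp: zero_power)
      have wn: "w ^ n = 1"
        unfolding w_def by (metis c power_int_1_left power_int_power power_int_power' mult.commute)
      have "w powi r = c powi (r * s)" by (simp add: w_def mult.commute flip: power_int_mult)
      also have "\<dots> = c powi (1 - int n * t)" using st by (metis add_diff_cancel_right')
      also have "\<dots> = c" using \<open>c \<noteq> 0\<close> c by (simp add: power_int_diff power_int_mult)
      finally have wr: "w powi r = c" .
      have "w \<noteq> 0" using wn n0 by (auto simp: zero_power)
      have "value_at F (w * a) = value_at (F \<circ>\<^sub>r (rconst w * zvar)) a"
        by (rule value_at_compose[OF nonconstant_scaling[OF \<open>w \<noteq> 0\<close>] value_at_scaling, symmetric])
      also have "F \<circ>\<^sub>r (rconst w * zvar) = rconst c * F"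
        unfolding F rotate_normal_form[OF n0 wn] wr ..
      also have "value_at (rconst c * F) a = y" using f y by (simp add: value_at_rconst_mult)
      finally show ?thesis using x wn
        by (intro exI[of _ "Pt (w * a)"]) (simp add: power_mult_distrib)
    qed
  qed
  then show ?thesis
    using image by (fastforce simp: fiber_product_def rat_map_zvar_power n0)
qed

section \<open>Good solutions\<close>

text \<open>
  A function with a left inverse under composition is injective where it is finite.
\<close>

lemma right_factor_of_zvar:
  assumes "zvar = h \<circ>\<^sub>r w" "nonconstant w"
  shows "rat_degree w \<le> 1"
proof (rule rat_degree_le_1_if_injective)
  fix x y c assume "value_at w x = Pt c" "value_at w y = Pt c"
  then have "value_at (h \<circ>\<^sub>r w) x = value_at (h \<circ>\<^sub>r w) y"
    by (simp only: value_at_compose[OF assms(2)])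
  then have "value_at zvar x = value_at zvar y" by (simp only: assms(1)[symmetric])
  moreover have "value_at zvar a = Pt a" for a by (simp add: value_at_Pt_iff has_value_zvar)
  ultimately show "x = y" by simp
qed

lemma rat_degree_pos:
  assumes "nonconstant w"
  shows "rat_degree w > 0"
proof (rule ccontr)
  assume "\<not> rat_degree w > 0"
  then obtain a b where ab: "numer w = [:a:]" "denom w = [:b:]"
    unfolding rat_degree_def by (metis degree_eq_zeroE max_nat.eq_neutr_iff not_gr0)
  then have "w = rconst (a / b)"
    using ratfun_quot[of w] by (simp add: divide_inverse rconst_inverse flip: rconst_def)
  then show False using assms by (simp add: nonconstant_def)
qed

text \<open>
  If $z^n = p'(w)$ and $F = q'(w)$, then $z^r = (q' / (R \circ p'))(w)$, and $rs + nt = 1$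
  exhibits $z = (z^r)^s (z^n)^t$ as a function of $w$.
\<close>

lemma no_common_right_factor_normal_form:
  assumes n: "n > 0" and r: "coprime r (int n)"
    and F: "F = zvar powi r * (R \<circ>\<^sub>r (zvar ^ n))" and F0: "F \<noteq> 0"
  shows "no_common_right_factor (zvar ^ n) F"
  unfolding no_common_right_factor_def
proof (intro allI impI)
  fix p' q' w
  assume *: "nonconstant p' \<and> nonconstant q' \<and> nonconstant w \<and> zvar ^ n = p' \<circ>\<^sub>r w \<and> F = q' \<circ>\<^sub>r w"
  then have w: "nonconstant w" and p': "nonconstant p'" by auto
  obtain s t where st: "r * s + int n * t = 1" using bezout_coprime_int[OF r] by blast
  have Rw: "R \<circ>\<^sub>r (zvar ^ n) = (R \<circ>\<^sub>r p') \<circ>\<^sub>r w"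
    using * by (simp add: rat_compose_assoc)
  have "R \<circ>\<^sub>r (zvar ^ n) \<noteq> 0" using F F0 by auto
  then have zr: "zvar powi r = (q' / (R \<circ>\<^sub>r p')) \<circ>\<^sub>r w"
    using F * by (simp add: rat_compose_divide[OF w] flip: Rw)
  have "zvar = zvar powi (r * s + int n * t)" using st by simp
  also have "\<dots> = (zvar powi r) powi s * (zvar ^ n) powi t"
    by (simp add: power_int_add power_int_mult)
  also have "\<dots> = ((q' / (R \<circ>\<^sub>r p')) powi s * p' powi t) \<circ>\<^sub>r w"
    using * unfolding zr by (simp add: rat_compose_mult[OF w] rat_compose_power_int[OF w])
  finally have "rat_degree w \<le> 1" using w by (rule right_factor_of_zvar)
  then show "rat_degree w = 1" using rat_degree_pos[OF w] by simp
qed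

lemma normal_form_good_solution:
  fixes R :: ratfun
  assumes n: "n \<ge> 2" and r: "coprime r (int n)"
    and A: "A = zvar powi r * R ^ n" and F: "F = zvar powi r * (R \<circ>\<^sub>r (zvar ^ n))"
    and nc: "nonconstant A" "nonconstant F"
  shows "good_solution A (zvar ^ n) (zvar ^ n) F"
  unfolding good_solution_def
proof (intro conjI)
  have n0: "n > 0" using n by simp
  show "nonconstant A" "nonconstant F" "nonconstant (zvar ^ n)" "nonconstant (zvar ^ n)"
    using nc nonconstant_zvar_power[OF n0] by simp_all
  show "A \<circ>\<^sub>r (zvar ^ n) = (zvar ^ n) \<circ>\<^sub>r F"
    unfolding A F compose_zvar_power_zvar_times_nth_power[OF n0]
    using nc(2) F by (simp add: rat_compose_power)
  show "no_common_right_factor (zvar ^ n) F"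
    using n0 r F nonconstant_nonzero[OF nc(2)] by (rule no_common_right_factor_normal_form)
  show "\<exists>!C. is_component C (fiber_product A (zvar ^ n))"
    unfolding fiber_product_parametrized[OF n r A F nonconstant_nonzero[OF nc(1)]]
    by (rule unique_component_if_irreducible[OF zariski_irreducible_range])
qed

text \<open>
  For $d = \gcd(r,n)$ the function $z^d$ is a right factor of both $z^n$ and $z^r R(z^n)$, so the absence of
  common right factors gives $d = 1$.
\<close>

lemma good_solution_normal_form:
  assumes n: "n > 0" and good: "good_solution A (zvar ^ n) (zvar ^ n) F"
  shows "\<exists>(R :: ratfun) (r :: int). coprime r (int n) \<and>
    A = zvar powi r * R ^ n \<and> F = zvar powi r * (R \<circ>\<^sub>r (zvar ^ n))"
proof -
  have F: "nonconstant F" and "A \<circ>\<^sub>r (zvar ^ n) = (zvar ^ n) \<circ>\<^sub>r F"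
    and ncrf: "no_common_right_factor (zvar ^ n) F"
    using good unfolding good_solution_def by blast+
  then have eq: "A \<circ>\<^sub>r (zvar ^ n) = F ^ n" by (simp add: rat_compose_power)
  obtain r R where R: "F = zvar powi r * (R \<circ>\<^sub>r (zvar ^ n))"
    using nth_power_in_zvar_power_imp_form[OF n nonconstant_nonzero[OF F] eq] by blast
  have nc: "nonconstant (zvar ^ n)" using n by (rule nonconstant_zvar_power)
  have "A \<circ>\<^sub>r (zvar ^ n) = (zvar powi r * R ^ n) \<circ>\<^sub>r (zvar ^ n)"
    unfolding compose_zvar_power_zvar_times_nth_power[OF n] eq R ..
  then have A: "A = zvar powi r * R ^ n" by (simp only: rat_compose_eq_iff[OF nc])
  define d where "d = nat (gcd r (int n))"
  have d: "d > 0" "int d = gcd r (int n)" using n by (simp_all add: d_def)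
  then have "int d dvd r" "int d dvd int n" by simp_all
  then obtain k m where k: "r = int d * k" and m: "n = d * m"
    unfolding int_dvd_int_iff by (elim dvdE)
  have m0: "m > 0" using n m by (cases m) auto
  note ncd = nonconstant_zvar_power[OF d(1)] and ncm = nonconstant_zvar_power[OF m0]
  define q where "q = zvar powi k * (R \<circ>\<^sub>r (zvar ^ m))"
  have zn: "zvar ^ n = (zvar ^ m) \<circ>\<^sub>r (zvar ^ d)"
    by (simp add: m rat_compose_power[OF ncd] flip: power_mult)
  have "(zvar powi k) \<circ>\<^sub>r (zvar ^ d) = zvar powi r"
    by (simp add: k rat_compose_power_int[OF ncd] power_int_mult)
  then have Fq: "F = q \<circ>\<^sub>r (zvar ^ d)"
    unfolding R q_def zn by (simp add: rat_compose_mult[OF ncd] rat_compose_assoc[OF ncm ncd])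
  have "nonconstant q" by (rule nonconstant_composeD) (use F Fq in simp)
  then have "rat_degree (zvar ^ d) = 1"
    using ncrf[unfolded no_common_right_factor_def, rule_format, of "zvar ^ m" q "zvar ^ d"]
      zn Fq ncd ncm by simp
  moreover have "rat_degree (zvar ^ d) = d"
    by (simp add: zvar_power rat_degree_def degree_monom_eq)
  ultimately have "gcd r (int n) = 1" using d by simp
  then have "coprime r (int n)" by (simp only: coprime_iff_gcd_eq_1)
  with A R show ?thesis by (intro exI conjI)
qed

theorem theorem5p1:
  fixes n :: nat
  assumes "n \<ge> 2"
  shows "(\<forall>A F. nonconstant A \<longrightarrow> nonconstant F \<longrightarrow>
            (good_solution A (zvar ^ n) (zvar ^ n) F \<longleftrightarrow>
             (\<exists>(R :: ratfun) (r :: int). coprime r (int n) \<and>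
                A = zvar powi r * R ^ n \<and>
                F = zvar powi r * (R \<circ>\<^sub>r (zvar ^ n))))) \<and>
         (\<forall>A. minimal_holomorphic_map (orbifold_0_infty n) A \<longrightarrow>
            (\<exists>(R :: ratfun) (r :: int). coprime r (int n) \<and> A = zvar powi r * R ^ n))"
proof (intro conjI allI impI iffI)
  fix A F assume "good_solution A (zvar ^ n) (zvar ^ n) F"
  with assms show "\<exists>(R :: ratfun) (r :: int). coprime r (int n) \<and>
      A = zvar powi r * R ^ n \<and> F = zvar powi r * (R \<circ>\<^sub>r (zvar ^ n))"
    by (intro good_solution_normal_form) simp_all
next
  fix A F assume "nonconstant A" "nonconstant F"
    and "\<exists>(R :: ratfun) (r :: int). coprime r (int n) \<and>
      A = zvar powi r * R ^ n \<and> F = zvar powi r * (R \<circ>\<^sub>r (zvar ^ n))"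
  then show "good_solution A (zvar ^ n) (zvar ^ n) F"
    using normal_form_good_solution[OF assms, of _ A _ F] by (elim exE conjE) simp
next
  fix A assume "minimal_holomorphic_map (orbifold_0_infty n) A"
  then show "\<exists>(R :: ratfun) (r :: int). coprime r (int n) \<and> A = zvar powi r * R ^ n"
    by (rule minimal_map_zvar_times_nth_power[OF assms])
qed

end
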